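(* Let $Q$ be a well typed query and $P$ a well typed program such that an atom is selectable in $P$ whenever its input positions of non-variable type are filled with non-variable terms. Then every left-based derivation of $P\cup\{Q\}$ is an LD-derivation.
   Context: A query is a finite sequence of atoms; a clause is $h\leftarrow B$ with $h$ an atom and $B$ a query. Every predicate has a fixed mode, i.e. each argument position is either input or output; $p(\mathbf s,\mathbf t)$ denotes an atom with $\mathbf s$ (resp. $\mathbf t$) the vector of terms filling the input (resp. output) positions. In clause heads $p(\mathbf t_0,\mathbf s_{n+1})$, $\mathbf t_0$ is the input and $\mathbf s_{n+1}$ the output. Types. A type is a set of terms closed under instantiation. The variable type is the type of all terms; any other type is a non-variable type. Each argument position of each predicate has an associated type. $t:T$ means $t\in T$ (componentwise for vectors); $\models \varphi\Rightarrow \mathbf t:\mathbf T$ means that the implication holds after applying any substitution to all terms. Well typed. A query $p_1(\mathbf s_1,\mathbf t_1),\dots,p_n(\mathbf s_n,\mathbf t_n)$, with $p_i(\mathbf S_i,\mathbf T_i)$ the type of $p_i$, is well typed if for all $i\in\{1,\dots,n\}$, $\models(\bigwedge_{1\le j<i}\mathbf t_j:\mathbf T_j)\Rightarrow\mathbf s_i:\mathbf S_i$. A clause $p(\mathbf t_0,\mathbf s_{n+1})\leftarrow p_1(\mathbf s_1,\mathbf t_1),\dots,p_n(\mathbf s_n,\mathbf t_n)$, with $p(\mathbf T_0,\mathbf S_{n+1})$ the type of $p$, is well typed if for all $i\in\{1,\dots,n+1\}$, $\models(\bigwedge_{0\le j<i}\mathbf t_j:\mathbf T_j)\Rightarrow\mathbf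 s_i:\mathbf S_i$. A program is well typed if all its clauses are. Derivations. A program consists of clauses and, for each predicate $p/n$, a block declaration: a (possibly empty) set of atoms $p(b_1,\dots,b_n)$ with $b_i\in\{?,-\}$. An atom $p(t_1,\dots,t_n)$ is blocked if for some $p(b_1,\dots,b_n)$ in the declaration, $t_i$ is a variable for all $i$ with $b_i=-$; otherwise it is selectable. In a derivation step a query $Q_1,a,Q_2$ is replaced by $(Q_1,B,Q_2)\theta$, where $h\leftarrow B$ is a variant, renamed apart, of a program clause and $\theta$ is a most general unifier of the selected atom $a$ and $h$. A derivation of $P\cup\{Q\}$ is a (finite or infinite) sequence of such steps starting at $Q$. An LD-derivation always selects the leftmost atom. A delay-respecting derivation always selects a selectable atom. In a step, the atoms of $B\theta$ are direct descendants of $a$, and $b\theta$ is a direct descendant of $b$ for $b$ in $Q_1,Q_2$; "descendant" is the reflexive transitive closure. In a delay-respecting derivation, if $Q_i=R_1,R_2$ where $R_1$ contains no selectable atom, then every descendant of every atom in $R_1$ is waiting. A delay-respecting derivation is left-based if in each step $Q_i;Q_{i+1}$ the selected atom is waiting in $Q_i$ or is the leftmost selectable atom in $Q_i$. *)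

theory Defs
  imports Main "HOL-Library.Extended_Nat" "HOL-Library.Infinite_Typeclass"
begin

datatype (trm_funs: 'f, trm_vars: 'v) trm =
  is_Var: Var 'v
| Fun 'f "('f, 'v) trm list"

datatype ('p, 'f, 'v) atm = Atm (pred: 'p) (args: "('f, 'v) trm list")

type_synonym ('p, 'f, 'v) query = "('p, 'f, 'v) atm list"

datatype ('p, 'f, 'v) clause = Clause (head: "('p, 'f, 'v) atm") (body: "('p, 'f, 'v) query")

definition atm_vars :: "('p, 'f, 'v) atm \<Rightarrow> 'v set" where
  "atm_vars a = (\<Union>t\<in>set (args a). trm_vars t)"

definition query_vars :: "('p, 'f, 'v) query \<Rightarrow> 'v set" where
  "query_vars Q = (\<Union>a\<in>set Q. atm_vars a)"

definition clause_vars :: "('p, 'f, 'v) clause \<Rightarrow> 'v set" where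
  "clause_vars c = atm_vars (head c) \<union> query_vars (body c)"

type_synonym ('f, 'v) subst = "'v \<Rightarrow> ('f, 'v) trm"

primrec trm_subst :: "('f, 'v) subst \<Rightarrow> ('f, 'v) trm \<Rightarrow> ('f, 'v) trm" where
  "trm_subst \<sigma> (Var x) = \<sigma> x"
| "trm_subst \<sigma> (Fun f ts) = Fun f (map (trm_subst \<sigma>) ts)"

definition atm_subst :: "('f, 'v) subst \<Rightarrow> ('p, 'f, 'v) atm \<Rightarrow> ('p, 'f, 'v) atm" where
  "atm_subst \<sigma> a = Atm (pred a) (map (trm_subst \<sigma>) (args a))"

definition query_subst :: "('f, 'v) subst \<Rightarrow> ('p, 'f, 'v) query \<Rightarrow> ('p, 'f, 'v) query" where
  "query_subst \<sigma> Q = map (atm_subst \<sigma>) Q"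

definition clause_subst :: "('f, 'v) subst \<Rightarrow> ('p, 'f, 'v) clause \<Rightarrow> ('p, 'f, 'v) clause" where
  "clause_subst \<sigma> c = Clause (atm_subst \<sigma> (head c)) (query_subst \<sigma> (body c))"

definition subst_vars :: "('f, 'v) subst \<Rightarrow> 'v set" where
  "subst_vars \<sigma> = (\<Union>x\<in>{x. \<sigma> x \<noteq> Var x}. insert x (trm_vars (\<sigma> x)))"

definition unifier :: "('f, 'v) subst \<Rightarrow> ('p, 'f, 'v) atm \<Rightarrow> ('p, 'f, 'v) atm \<Rightarrow> bool" where
  "unifier \<sigma> a b \<longleftrightarrow> atm_subst \<sigma> a = atm_subst \<sigma> b"

definition is_mgu :: "('f, 'v) subst \<Rightarrow> ('p, 'f, 'v) atm \<Rightarrow> ('p, 'f, 'v) atm \<Rightarrow> bool" where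
  "is_mgu \<theta> a b \<longleftrightarrow> unifier \<theta> a b \<and>
     (\<forall>\<tau>. unifier \<tau> a b \<longrightarrow> (\<exists>\<gamma>. \<forall>x. \<tau> x = trm_subst \<gamma> (\<theta> x)))"

definition clause_variant :: "('p, 'f, 'v) clause \<Rightarrow> ('p, 'f, 'v) clause \<Rightarrow> bool" where
  "clause_variant c' c \<longleftrightarrow> (\<exists>\<rho>. bij \<rho> \<and> c' = clause_subst (\<lambda>x. Var (\<rho> x)) c)"

datatype io = In | Out

text \<open>The mode of a predicate also fixes its arity: \<open>p\<close> has \<open>length (M p)\<close> argument positions.\<close>

type_synonym 'p moding = "'p \<Rightarrow> io list"
type_synonym ('p, 'f, 'v) typing = "'p \<Rightarrow> ('f, 'v) trm set list"

definition is_type :: "('f, 'v) trm set \<Rightarrow> bool" where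
  "is_type T \<longleftrightarrow> (\<forall>t\<in>T. \<forall>\<sigma>. trm_subst \<sigma> t \<in> T)"

definition variable_type :: "('f, 'v) trm set" where
  "variable_type = UNIV"

definition typing_for :: "'p moding \<Rightarrow> ('p, 'f, 'v) typing \<Rightarrow> bool" where
  "typing_for M \<T> \<longleftrightarrow> (\<forall>p. length (\<T> p) = length (M p) \<and> (\<forall>T\<in>set (\<T> p). is_type T))"

definition positions :: "io \<Rightarrow> io list \<Rightarrow> 'x list \<Rightarrow> 'x list" where
  "positions d ms xs = map snd (filter (\<lambda>(m, x). m = d) (zip ms xs))"

text \<open>\<open>typed_at M \<T> d a\<close>: the vector of terms filling the positions of \<open>a\<close> of direction \<open>d\<close>
  (input or output) belongs componentwise to the vector of types of these positions.\<close>

definition typed_at ::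
  "'p moding \<Rightarrow> ('p, 'f, 'v) typing \<Rightarrow> io \<Rightarrow> ('p, 'f, 'v) atm \<Rightarrow> bool" where
  "typed_at M \<T> d a \<longleftrightarrow>
     list_all2 (\<in>) (positions d (M (pred a)) (args a)) (positions d (M (pred a)) (\<T> (pred a)))"

definition well_typed_query ::
  "'p moding \<Rightarrow> ('p, 'f, 'v) typing \<Rightarrow> ('p, 'f, 'v) query \<Rightarrow> bool" where
  "well_typed_query M \<T> Q \<longleftrightarrow>
     (\<forall>i<length Q. \<forall>\<sigma>.
        (\<forall>j<i. typed_at M \<T> Out (atm_subst \<sigma> (Q ! j))) \<longrightarrow>
        typed_at M \<T> In (atm_subst \<sigma> (Q ! i)))"

definition well_typed_clause ::
  "'p moding \<Rightarrow> ('p, 'f, 'v) typing \<Rightarrow> ('p, 'f, 'v) clause \<Rightarrow> bool" where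
  "well_typed_clause M \<T> c \<longleftrightarrow>
     (\<forall>i<length (body c). \<forall>\<sigma>.
        typed_at M \<T> In (atm_subst \<sigma> (head c)) \<and>
        (\<forall>j<i. typed_at M \<T> Out (atm_subst \<sigma> (body c ! j))) \<longrightarrow>
        typed_at M \<T> In (atm_subst \<sigma> (body c ! i))) \<and>
     (\<forall>\<sigma>.
        typed_at M \<T> In (atm_subst \<sigma> (head c)) \<and>
        (\<forall>j<length (body c). typed_at M \<T> Out (atm_subst \<sigma> (body c ! j))) \<longrightarrow>
        typed_at M \<T> Out (atm_subst \<sigma> (head c)))"

datatype block_mark = QMark | Dash

text \<open>The declaration atom \<open>p(b\<^sub>1, \<dots>, b\<^sub>n)\<close> is represented by the list of its arguments.\<close>

record ('p, 'f, 'v) program =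
  clauses :: "('p, 'f, 'v) clause set"
  blocks :: "'p \<Rightarrow> block_mark list set"

definition atm_over :: "'p moding \<Rightarrow> ('p, 'f, 'v) atm \<Rightarrow> bool" where
  "atm_over M a \<longleftrightarrow> length (args a) = length (M (pred a))"

definition query_over :: "'p moding \<Rightarrow> ('p, 'f, 'v) query \<Rightarrow> bool" where
  "query_over M Q \<longleftrightarrow> (\<forall>a\<in>set Q. atm_over M a)"

definition program_over :: "'p moding \<Rightarrow> ('p, 'f, 'v) program \<Rightarrow> bool" where
  "program_over M P \<longleftrightarrow>
     (\<forall>c\<in>clauses P. atm_over M (head c) \<and> query_over M (body c)) \<and>
     (\<forall>p. \<forall>b\<in>blocks P p. length b = length (M p))"

definition well_typed_program ::
  "'p moding \<Rightarrow> ('p, 'f, 'v) typing \<Rightarrow> ('p, 'f, 'v) program \<Rightarrow> bool" where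
  "well_typed_program M \<T> P \<longleftrightarrow> (\<forall>c\<in>clauses P. well_typed_clause M \<T> c)"

definition blocked :: "('p, 'f, 'v) program \<Rightarrow> ('p, 'f, 'v) atm \<Rightarrow> bool" where
  "blocked P a \<longleftrightarrow>
     (\<exists>b\<in>blocks P (pred a). \<forall>i<length b. b ! i = Dash \<longrightarrow> is_Var (args a ! i))"

definition selectable :: "('p, 'f, 'v) program \<Rightarrow> ('p, 'f, 'v) atm \<Rightarrow> bool" where
  "selectable P a \<longleftrightarrow> \<not> blocked P a"

text \<open>
  A finite or infinite derivation: step \<open>i\<close>, which leads from \<open>queries D i\<close> to
  \<open>queries D (Suc i)\<close>, exists iff \<open>enat i < steps D\<close>. It resolves the atom at position
  \<open>chosen D i\<close> (counted from \<open>0\<close>) with the clause variant \<open>variants D i\<close> and the mgu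
  \<open>mgus D i\<close>. Values of the fields beyond the end of a finite derivation are irrelevant.
\<close>

record ('p, 'f, 'v) deriv =
  steps :: enat
  queries :: "nat \<Rightarrow> ('p, 'f, 'v) query"
  chosen :: "nat \<Rightarrow> nat"
  variants :: "nat \<Rightarrow> ('p, 'f, 'v) clause"
  mgus :: "nat \<Rightarrow> ('f, 'v) subst"

text \<open>
  Standardisation apart: a clause variant shares no variable with the initial query or with the
  clause variants and mgus of the earlier steps (hence none with the current query).
\<close>

definition renamed_apart :: "('p, 'f, 'v) deriv \<Rightarrow> nat \<Rightarrow> bool" where
  "renamed_apart D i \<longleftrightarrow>
     clause_vars (variants D i) \<inter>
       (query_vars (queries D 0) \<union>
        (\<Union>j<i. clause_vars (variants D j) \<union> subst_vars (mgus D j))) = {}"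

definition derivation_step :: "('p, 'f, 'v) program \<Rightarrow> ('p, 'f, 'v) deriv \<Rightarrow> nat \<Rightarrow> bool" where
  "derivation_step P D i \<longleftrightarrow>
     (\<exists>Q\<^sub>1 a Q\<^sub>2.
        queries D i = Q\<^sub>1 @ a # Q\<^sub>2 \<and> length Q\<^sub>1 = chosen D i \<and>
        (\<exists>c\<in>clauses P. clause_variant (variants D i) c) \<and>
        renamed_apart D i \<and>
        is_mgu (mgus D i) a (head (variants D i)) \<and>
        queries D (Suc i) = query_subst (mgus D i) (Q\<^sub>1 @ body (variants D i) @ Q\<^sub>2))"

definition derivation ::
  "('p, 'f, 'v) program \<Rightarrow> ('p, 'f, 'v) query \<Rightarrow> ('p, 'f, 'v) deriv \<Rightarrow> bool" where
  "derivation P Q D \<longleftrightarrow>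
     queries D 0 = Q \<and> (\<forall>i. enat i < steps D \<longrightarrow> derivation_step P D i)"

definition LD_derivation ::
  "('p, 'f, 'v) program \<Rightarrow> ('p, 'f, 'v) query \<Rightarrow> ('p, 'f, 'v) deriv \<Rightarrow> bool" where
  "LD_derivation P Q D \<longleftrightarrow>
     derivation P Q D \<and> (\<forall>i. enat i < steps D \<longrightarrow> chosen D i = 0)"

definition delay_respecting ::
  "('p, 'f, 'v) program \<Rightarrow> ('p, 'f, 'v) query \<Rightarrow> ('p, 'f, 'v) deriv \<Rightarrow> bool" where
  "delay_respecting P Q D \<longleftrightarrow>
     derivation P Q D \<and>
     (\<forall>i. enat i < steps D \<longrightarrow> selectable P (queries D i ! chosen D i))"

text \<open>
  The pair \<open>(i, k)\<close> denotes the atom occurrence at position \<open>k\<close> of \<open>queries D i\<close>. In a step the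
  chosen occurrence is replaced by the \<open>length (body (variants D i))\<close> occurrences of the body.
\<close>

inductive_set direct_descendant :: "('p, 'f, 'v) deriv \<Rightarrow> ((nat \<times> nat) \<times> (nat \<times> nat)) set"
  for D :: "('p, 'f, 'v) deriv" where
  left: "enat i < steps D \<Longrightarrow> k < chosen D i \<Longrightarrow>
           ((i, k), (Suc i, k)) \<in> direct_descendant D"
| body: "enat i < steps D \<Longrightarrow> m < length (body (variants D i)) \<Longrightarrow>
           ((i, chosen D i), (Suc i, chosen D i + m)) \<in> direct_descendant D"
| right: "enat i < steps D \<Longrightarrow> chosen D i < k \<Longrightarrow> k < length (queries D i) \<Longrightarrow>
           ((i, k), (Suc i, k - 1 + length (body (variants D i)))) \<in> direct_descendant D"

definition waiting :: "('p, 'f, 'v) program \<Rightarrow> ('p, 'f, 'v) deriv \<Rightarrow> nat \<times> nat \<Rightarrow> bool" where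
  "waiting P D x \<longleftrightarrow>
     (\<exists>i k R\<^sub>1 R\<^sub>2.
        enat i \<le> steps D \<and> queries D i = R\<^sub>1 @ R\<^sub>2 \<and>
        (\<forall>a\<in>set R\<^sub>1. \<not> selectable P a) \<and>
        k < length R\<^sub>1 \<and> ((i, k), x) \<in> (direct_descendant D)\<^sup>*)"

definition leftmost_selectable :: "('p, 'f, 'v) program \<Rightarrow> ('p, 'f, 'v) query \<Rightarrow> nat \<Rightarrow> bool" where
  "leftmost_selectable P Q k \<longleftrightarrow>
     k < length Q \<and> selectable P (Q ! k) \<and> (\<forall>l<k. \<not> selectable P (Q ! l))"

definition left_based ::
  "('p, 'f, 'v) program \<Rightarrow> ('p, 'f, 'v) query \<Rightarrow> ('p, 'f, 'v) deriv \<Rightarrow> bool" where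
  "left_based P Q D \<longleftrightarrow>
     delay_respecting P Q D \<and>
     (\<forall>i. enat i < steps D \<longrightarrow>
        waiting P D (i, chosen D i) \<or> leftmost_selectable P (queries D i) (chosen D i))"

end

theory Submission
  imports Defs
begin

text \<open>
  Resolving any atom of a well typed query against a well typed clause yields a well typed query:
  the inputs of the selected atom, hence those of the clause head, become correct once the outputs
  to the left are, and the clause hands this on to its body and back to the outputs. The input of
  the leftmost atom of a well typed query is correct without any premise. Since a type containing a
  variable contains all terms, that atom has non-variable terms in its input positions of
  non-variable type, so it is selectable. Hence no atom is ever waiting, and a left-based
  derivation can only select leftmost atoms.
\<close>

lemma trm_subst_Var: "trm_subst Var t = t"
  by (induction t) (simp_all add: map_idI)

lemma atm_subst_Var: "atm_subst Var a = a"
  by (cases a) (simp add: atm_subst_def trm_subst_Var map_idI)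

lemma trm_subst_trm_subst:
  "trm_subst \<sigma> (trm_subst \<theta> t) = trm_subst (\<lambda>x. trm_subst \<sigma> (\<theta> x)) t"
  by (induction t) simp_all

lemma atm_subst_atm_subst:
  "atm_subst \<sigma> (atm_subst \<theta> a) = atm_subst (\<lambda>x. trm_subst \<sigma> (\<theta> x)) a"
  by (simp add: atm_subst_def trm_subst_trm_subst)

lemma set_query_subst: "set (query_subst \<sigma> Q) = atm_subst \<sigma> ` set Q"
  by (simp add: query_subst_def)

lemma atm_over_atm_subst [simp]: "atm_over M (atm_subst \<sigma> a) = atm_over M a"
  by (simp add: atm_over_def atm_subst_def)

lemma query_over_query_subst [simp]: "query_over M (query_subst \<sigma> Q) = query_over M Q"
  by (simp add: query_over_def set_query_subst)

text \<open>Types are closed under instantiation, and a variable can be instantiated to any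
  term.\<close>

lemma type_containing_Var:
  assumes "is_type T" and "Var x \<in> T"
  shows "T = variable_type"
proof -
  have "t \<in> T" for t
  proof -
    have "trm_subst (\<lambda>_. t) (Var x) \<in> T"
      using assms unfolding is_type_def by blast
    then show ?thesis
      by simp
  qed
  then show ?thesis
    by (auto simp: variable_type_def)
qed

text \<open>Both lists are filtered by the same modes and so stay aligned. This turns
  \<open>typed_at\<close> into a statement about a single argument index.\<close>

lemma list_all2_positionsD:
  assumes "list_all2 R (positions d ms xs) (positions d ms ys)"
    and "i < length ms" "length xs = length ms" "length ys = length ms" "ms ! i = d"
  shows "R (xs ! i) (ys ! i)"
  using assms
proof (induction ms arbitrary: i xs ys)
  case (Cons m ms)
  then show ?case
    by (cases xs; cases ys; cases i) (auto simp: positions_def split: if_splits)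
qed simp

text \<open>Well-typedness as a list recursion: \<open>ok_in\<close> and \<open>ok_out\<close> stand for correctness of the inputs
  and of the outputs under a fixed instance.\<close>

primrec chained :: "('a \<Rightarrow> bool) \<Rightarrow> ('a \<Rightarrow> bool) \<Rightarrow> 'a list \<Rightarrow> bool" where
  "chained ok_in ok_out [] \<longleftrightarrow> True"
| "chained ok_in ok_out (x # xs) \<longleftrightarrow> ok_in x \<and> (ok_out x \<longrightarrow> chained ok_in ok_out xs)"

lemma chained_append:
  "chained ok_in ok_out (xs @ ys) \<longleftrightarrow>
     chained ok_in ok_out xs \<and> ((\<forall>x\<in>set xs. ok_out x) \<longrightarrow> chained ok_in ok_out ys)"
  by (induction xs) auto

lemma chained_map: "chained ok_in ok_out (map f xs) \<longleftrightarrow> chained (ok_in \<circ> f) (ok_out \<circ> f) xs"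
  by (induction xs) auto

lemma chained_iff_nth:
  "chained ok_in ok_out xs \<longleftrightarrow> (\<forall>i<length xs. (\<forall>j<i. ok_out (xs ! j)) \<longrightarrow> ok_in (xs ! i))"
  by (induction xs) (auto simp: All_less_Suc2)

abbreviation typed_instance where
  "typed_instance M \<T> d \<sigma> \<equiv> \<lambda>a. typed_at M \<T> d (atm_subst \<sigma> a)"

abbreviation chained_instance where
  "chained_instance M \<T> \<sigma> \<equiv> chained (typed_instance M \<T> In \<sigma>) (typed_instance M \<T> Out \<sigma>)"

text \<open>With the substitution quantified outermost, resolution can be analysed for one fixed
  instance at a time.\<close>

lemma well_typed_query_iff_chained:
  "well_typed_query M \<T> Q \<longleftrightarrow> (\<forall>\<sigma>. chained_instance M \<T> \<sigma> Q)"
  by (auto simp: well_typed_query_def chained_iff_nth)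

lemma well_typed_clause_iff_chained:
  "well_typed_clause M \<T> c \<longleftrightarrow>
     (\<forall>\<sigma>. typed_instance M \<T> In \<sigma> (head c) \<longrightarrow>
        chained_instance M \<T> \<sigma> (body c) \<and>
        ((\<forall>b\<in>set (body c). typed_instance M \<T> Out \<sigma> b) \<longrightarrow>
          typed_instance M \<T> Out \<sigma> (head c)))"
  unfolding well_typed_clause_def chained_iff_nth all_set_conv_all_nth by blast

lemma chained_instance_query_subst:
  "chained_instance M \<T> \<sigma> (query_subst \<theta> Q) \<longleftrightarrow>
     chained_instance M \<T> (\<lambda>x. trm_subst \<sigma> (\<theta> x)) Q"
  by (simp add: query_subst_def chained_map comp_def atm_subst_atm_subst)

lemma well_typed_clause_subst:
  assumes "well_typed_clause M \<T> c"
  shows "well_typed_clause M \<T> (clause_subst \<theta> c)"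
  using assms
  by (simp add: well_typed_clause_iff_chained clause_subst_def chained_instance_query_subst
      atm_subst_atm_subst set_query_subst)

text \<open>Every instance of the resolvent is an instance of its parts under the composed
  substitution \<open>?\<tau>\<close>, where \<open>a\<close> and \<open>head c\<close> coincide. So
  the body of \<open>c\<close> can take the place of \<open>a\<close> in the chain.\<close>

lemma well_typed_query_resolvent:
  assumes Q: "well_typed_query M \<T> (Q\<^sub>1 @ a # Q\<^sub>2)"
    and c: "well_typed_clause M \<T> c"
    and \<theta>: "unifier \<theta> a (head c)"
  shows "well_typed_query M \<T> (query_subst \<theta> (Q\<^sub>1 @ body c @ Q\<^sub>2))"
  unfolding well_typed_query_iff_chained chained_instance_query_subst
proof
  fix \<sigma>
  let ?\<tau> = "\<lambda>x. trm_subst \<sigma> (\<theta> x)"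
  have "atm_subst ?\<tau> a = atm_subst ?\<tau> (head c)"
    using \<theta> unfolding unifier_def by (metis atm_subst_atm_subst)
  moreover have "chained_instance M \<T> ?\<tau> (Q\<^sub>1 @ a # Q\<^sub>2)"
    using Q by (simp add: well_typed_query_iff_chained)
  ultimately show "chained_instance M \<T> ?\<tau> (Q\<^sub>1 @ body c @ Q\<^sub>2)"
    using c[unfolded well_typed_clause_iff_chained, rule_format, of ?\<tau>]
    by (auto simp: chained_append)
qed

text \<open>The bound \<open>\<le>\<close> covers the last query of a finite derivation, which
  \<open>waiting\<close> may also refer to. Arities are carried along since both argument indexing
  and the selectability hypothesis need them.\<close>

lemma derivation_invariant:
  assumes P: "program_over M P" "well_typed_program M \<T> P"
    and Q: "query_over M Q" "well_typed_query M \<T> Q"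
    and D: "derivation P Q D"
    and "enat i \<le> steps D"
  shows "query_over M (queries D i) \<and> well_typed_query M \<T> (queries D i)"
  using \<open>enat i \<le> steps D\<close>
proof (induction i)
  case 0
  then show ?case
    using D Q by (simp add: derivation_def)
next
  case (Suc i)
  then have "enat i < steps D"
    by (simp add: Suc_ile_eq)
  with Suc.IH D
  have IH: "query_over M (queries D i)" "well_typed_query M \<T> (queries D i)"
    and "derivation_step P D i"
    by (auto simp: derivation_def)
  then obtain Q\<^sub>1 a Q\<^sub>2 c \<rho> where Qi: "queries D i = Q\<^sub>1 @ a # Q\<^sub>2"
    and c: "c \<in> clauses P" "variants D i = clause_subst (\<lambda>x. Var (\<rho> x)) c"
    and mgu: "is_mgu (mgus D i) a (head (variants D i))"
    and Suc_i: "queries D (Suc i) =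
      query_subst (mgus D i) (Q\<^sub>1 @ body (variants D i) @ Q\<^sub>2)"
    unfolding derivation_step_def clause_variant_def by blast
  have "query_over M (body (variants D i))"
    using P(1) c by (simp add: program_over_def clause_subst_def)
  then have "query_over M (queries D (Suc i))"
    using IH(1) by (simp add: Qi Suc_i) (auto simp: query_over_def)
  \<comment> \<open>A variant is a substitution instance, by a renaming.\<close>
  moreover have "well_typed_clause M \<T> (variants D i)"
    using P(2) c by (simp add: well_typed_program_def well_typed_clause_subst)
  then have "well_typed_query M \<T> (queries D (Suc i))"
    using IH(2) mgu well_typed_query_resolvent unfolding Qi Suc_i is_mgu_def by blast
  ultimately show ?case
    by blast
qed

lemma typed_input_not_Var:
  assumes "typing_for M \<T>" and "atm_over M a" and "typed_at M \<T> In a"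
    and "i < length (args a)" and "M (pred a) ! i = In"
    and "\<T> (pred a) ! i \<noteq> variable_type"
  shows "\<not> is_Var (args a ! i)"
proof
  assume "is_Var (args a ! i)"
  then obtain x where x: "args a ! i = Var x"
    by (auto simp: is_Var_def)
  have len: "length (\<T> (pred a)) = length (M (pred a))"
      "length (args a) = length (M (pred a))"
    using assms(1,2) by (simp_all add: typing_for_def atm_over_def)
  then have "args a ! i \<in> \<T> (pred a) ! i"
    using assms(3-5) by (intro list_all2_positionsD) (auto simp: typed_at_def)
  moreover have "is_type (\<T> (pred a) ! i)"
    using assms(1,4) len by (metis typing_for_def nth_mem)
  ultimately show False
    using assms(6) x by (metis type_containing_Var)
qed

theorem proposition4p2:
  fixes M :: "'p moding"
    and \<T> :: "('p, 'f, 'v::infinite) typing"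
    and P :: "('p, 'f, 'v) program"
    and Q :: "('p, 'f, 'v) query"
    and D :: "('p, 'f, 'v) deriv"
  assumes "typing_for M \<T>"
    and "program_over M P"
    and "query_over M Q"
    and "well_typed_query M \<T> Q"
    and "well_typed_program M \<T> P"
    and "\<And>a :: ('p, 'f, 'v) atm.
           atm_over M a \<Longrightarrow>
           (\<forall>i<length (args a).
              M (pred a) ! i = In \<and> \<T> (pred a) ! i \<noteq> variable_type \<longrightarrow>
              \<not> is_Var (args a ! i)) \<Longrightarrow>
           selectable P a"
    and "left_based P Q D"
  shows "LD_derivation P Q D"
proof -
  have D: "derivation P Q D"
    using assms(7) by (simp add: left_based_def delay_respecting_def)
  have hd_selectable: "selectable P a" if "enat i \<le> steps D" "queries D i = a # R" for i a R
  proof -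
    have "atm_over M a" and wt: "well_typed_query M \<T> (a # R)"
      using derivation_invariant[OF assms(2,5,3,4) D that(1)] that(2)
      by (auto simp: query_over_def)
    \<comment> \<open>The first link of the chain has no premise; the identity substitution yields
      the atom itself.\<close>
    moreover from wt have "typed_at M \<T> In (atm_subst Var a)"
      by (simp add: well_typed_query_iff_chained)
    ultimately show ?thesis
      using assms(6) typed_input_not_Var[OF assms(1)] by (simp add: atm_subst_Var)
  qed
  have no_waiting: "\<not> waiting P D x" for x
  proof
    assume "waiting P D x"
    then obtain i k R\<^sub>1 R\<^sub>2 where "enat i \<le> steps D" "queries D i = R\<^sub>1 @ R\<^sub>2"
      "\<forall>a\<in>set R\<^sub>1. \<not> selectable P a" "k < length R\<^sub>1"
      unfolding waiting_def by blast
    \<comment> \<open>Since \<open>k < length R\<^sub>1\<close>, the prefix is nonempty, and its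
      first atom is the selectable head of the query.\<close>
    then show False
      using hd_selectable by (cases R\<^sub>1) auto
  qed
  have "chosen D i = 0" if "enat i < steps D" for i
  proof -
    have "leftmost_selectable P (queries D i) (chosen D i)"
      using assms(7) that no_waiting by (auto simp: left_based_def)
    \<comment> \<open>A positive index would make the atom at position 0 unselectable.\<close>
    then show ?thesis
      using hd_selectable[of i] that
      by (cases "queries D i") (auto simp: leftmost_selectable_def intro: less_imp_le)
  qed
  with D show ?thesis
    by (simp add: LD_derivation_def)
qed

end
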